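(* Let $1 < p < \infty$ and $\mathbb{X} = \ell_p^2(\mathbb{C})$. Then $T \in \mathbb{L}(\mathbb{X})$ is left symmetric if and only if $T$ is the zero operator.
   Context: $\ell_p^2(\mathbb{C})$ is $\mathbb{C}^2$ with the norm $\|(z_1,z_2)\| = (|z_1|^p + |z_2|^p)^{1/p}$. $\mathbb{L}(\mathbb{X})$ is the space of bounded linear operators on $\mathbb{X}$ with the operator norm. For $T, A \in \mathbb{L}(\mathbb{X})$, $T \perp_B A$ (Birkhoff-James orthogonality) means $\|T + \lambda A\| \ge \|T\|$ for all $\lambda \in \mathbb{C}$. An operator $T \in \mathbb{L}(\mathbb{X})$ is left symmetric if for every $A \in \mathbb{L}(\mathbb{X})$, $T \perp_B A$ implies $A \perp_B T$. *)

theory Defs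
  imports "HOL-Analysis.Analysis"
begin

text \<open>
  The exponent \<open>p\<close> varies over the reals, so the space cannot be a type whose class norm is the
  \<open>p\<close>-norm. We take the type \<open>complex ^ 2\<close> for the underlying vector space (complex scalar
  multiplication is \<open>*s\<close>) and carry the norm explicitly; the class norm of \<open>complex ^ 2\<close>, which
  is Euclidean, is not used.
\<close>

definition lp_norm :: "real \<Rightarrow> complex ^ 2 \<Rightarrow> real" where
  "lp_norm p z = (cmod (z $ 1) powr p + cmod (z $ 2) powr p) powr (1 / p)"

definition operators :: "real \<Rightarrow> (complex ^ 2 \<Rightarrow> complex ^ 2) set" where
  "operators p = {T. Vector_Spaces.linear (*s) (*s) T \<and> (\<exists>K. \<forall>z. lp_norm p (T z) \<le> K * lp_norm p z)}"

definition op_norm :: "real \<Rightarrow> (complex ^ 2 \<Rightarrow> complex ^ 2) \<Rightarrow> real" where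
  "op_norm p T = (SUP z\<in>{z. lp_norm p z = 1}. lp_norm p (T z))"

definition bj_orthogonal ::
    "real \<Rightarrow> (complex ^ 2 \<Rightarrow> complex ^ 2) \<Rightarrow> (complex ^ 2 \<Rightarrow> complex ^ 2) \<Rightarrow> bool" where
  "bj_orthogonal p T A \<longleftrightarrow> (\<forall>c::complex. op_norm p (\<lambda>z. T z + c *s A z) \<ge> op_norm p T)"

definition left_symmetric :: "real \<Rightarrow> (complex ^ 2 \<Rightarrow> complex ^ 2) \<Rightarrow> bool" where
  "left_symmetric p T \<longleftrightarrow> (\<forall>A\<in>operators p. bj_orthogonal p T A \<longrightarrow> bj_orthogonal p A T)"

end

theory Submission
  imports Defs
begin

text \<open>
  The zero operator is clearly left symmetric. For the converse, let \<open>T \<noteq> 0\<close>, let \<open>x\<close> be a unit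
  vector at which \<open>T\<close> attains its norm, and write \<open>J\<^sub>w\<close> for the support functional
  of \<open>w\<close>, so that \<open>w\<close> is orthogonal to the kernel of \<open>J\<^sub>w\<close>.

  For every operator \<open>B\<close> some multiple \<open>c T\<close> makes \<open>A = B - c T\<close> satisfy \<open>J\<^sub>T\<^sub>x (A x) = 0\<close>, and
  then \<open>T\<close> is orthogonal to \<open>A\<close>. If \<open>T\<close> were left symmetric, \<open>A\<close> would be orthogonal to \<open>T\<close>,
  hence \<open>\<parallel>B - c T\<parallel> \<le> \<parallel>A + c T\<parallel> = \<parallel>B\<parallel>\<close>. So it is enough to find one \<open>B\<close> whose norm grows when
  \<open>c T\<close> is subtracted (\<open>not_left_symmetricI\<close>). By strict convexity of the norm this happens as
  soon as \<open>B\<close> attains its norm at some \<open>z\<close> with \<open>J\<^sub>B\<^sub>z (T z) = 0\<close> and \<open>T z \<noteq> 0\<close>, while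
  \<open>c \<noteq> 0\<close> (\<open>not_left_symmetricI_support\<close>).

  The vector \<open>T x\<close> is orthogonal to exactly one line, spanned by some \<open>u\<close>. If the range of \<open>T\<close>
  is not contained in the kernel of \<open>J\<^sub>u\<close>, a rank-one \<open>B\<close> will do
  (\<open>not_left_symmetric_of_asymmetric_range\<close>). Otherwise the range is the line through \<open>T x\<close>.
  An isometry \<open>B\<close> attains its norm everywhere, which leaves \<open>z\<close> free; a monomial isometry
  with a suitable phase works (\<open>not_left_symmetric_rank_one\<close>) unless \<open>T\<close> is a multiple of a matrix
  unit. For those, \<open>B\<close> is a multiple of a Hadamard matrix: Clarkson's inequalities bound its norm,
  and deleting one of its entries makes the norm larger (\<open>not_left_symmetric_matrix_unit\<close>).
\<close>

section \<open>Inequalities for powers\<close>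

text \<open>
  Bernoulli's inequality for real exponents. Its strictness is the source of the strict convexity
  of the \<open>p\<close>-norm.
\<close>

lemma powr_gt_tangent_at_one:
  fixes u p :: real
  assumes "1 < p" "0 \<le> u" "u \<noteq> 1"
  shows "1 + p * (u - 1) < u powr p"
proof (cases "u = 0")
  case True
  then show ?thesis using assms by simp
next
  case False
  then have u: "0 < u" using assms by simp
  have deriv: "DERIV (\<lambda>x. x powr p) x :> p * x powr (p - 1)" if "0 < x" for x :: real
    using that by (auto intro!: derivative_eq_intros)
  show ?thesis
  proof (cases "1 < u")
    case True
    from MVT2[OF True, of "\<lambda>x. x powr p" "\<lambda>x. p * x powr (p - 1)"] deriv
    obtain z where z: "1 < z" "z < u" "u powr p - 1 powr p = (u - 1) * (p * z powr (p - 1))" by auto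
    have "1 powr (p - 1) < z powr (p - 1)" using z assms by (intro powr_less_mono2) auto
    then have "(u - 1) * (p * 1) < (u - 1) * (p * z powr (p - 1))"
      using True assms by (intro mult_strict_left_mono) auto
    then show ?thesis using z by (simp add: algebra_simps)
  next
    case False
    then have u1: "u < 1" using assms by simp
    from MVT2[OF u1, of "\<lambda>x. x powr p" "\<lambda>x. p * x powr (p - 1)"] deriv u
    obtain z where z: "u < z" "z < 1" "1 powr p - u powr p = (1 - u) * (p * z powr (p - 1))" by auto
    have "z powr (p - 1) < 1 powr (p - 1)" using z u assms by (intro powr_less_mono2) auto
    then have "(1 - u) * (p * z powr (p - 1)) < (1 - u) * (p * 1)"
      using u1 assms by (intro mult_strict_left_mono) auto
    then show ?thesis using z by (simp add: algebra_simps)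
  qed
qed

lemma powr_add_superadditive:
  fixes x y t :: real
  assumes "1 \<le> t" "0 \<le> x" "0 \<le> y"
  shows "x powr t + y powr t \<le> (x + y) powr t"
proof (cases "x + y = 0")
  case False
  then have s: "0 < x + y" using assms by simp
  have le: "a powr t \<le> a * (x + y) powr (t - 1)" if "0 \<le> a" "a \<le> x + y" for a
  proof (cases "a = 0")
    case False
    then have "a powr t = a * a powr (t - 1)" using that by (simp add: powr_mult_base)
    also have "\<dots> \<le> a * (x + y) powr (t - 1)"
      using that assms by (intro mult_left_mono powr_mono2) auto
    finally show ?thesis .
  qed simp
  have "x powr t + y powr t \<le> (x + y) * (x + y) powr (t - 1)"
    using le[of x] le[of y] assms by (simp add: algebra_simps)
  also have "\<dots> = (x + y) powr t" using s by (simp add: powr_mult_base)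
  finally show ?thesis .
next
  case True
  then have "x = 0" "y = 0" using assms by auto
  then show ?thesis by simp
qed

lemma powr_add_le_power_mean:
  fixes x y t :: real
  assumes "1 \<le> t" "0 \<le> x" "0 \<le> y"
  shows "(x + y) powr t \<le> 2 powr (t - 1) * (x powr t + y powr t)"
proof (cases "x = 0 \<or> y = 0")
  case True
  have "1 \<le> (2::real) powr (t - 1)" using assms by (simp add: ge_one_powr_ge_zero)
  then have "1 * (x powr t + y powr t) \<le> 2 powr (t - 1) * (x powr t + y powr t)"
    by (rule mult_right_mono) simp
  then show ?thesis using True by auto
next
  case False
  then have "((1 - 1/2) *\<^sub>R x + (1/2) *\<^sub>R y) powr t \<le> (1 - 1/2) * x powr t + (1/2) * y powr t"
    using convex_onD[OF powr_convex[OF assms(1)], of "1/2" x y] assms by simp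
  then have "((x + y) / 2) powr t \<le> (x powr t + y powr t) / 2" by (simp add: field_simps)
  then have "(x + y) powr t \<le> 2 powr t / 2 * (x powr t + y powr t)"
    by (simp add: powr_divide field_simps)
  then show ?thesis by (simp add: powr_diff)
qed

lemma powr_add_subadditive:
  fixes x y t :: real
  assumes "0 < t" "t \<le> 1" "0 \<le> x" "0 \<le> y"
  shows "(x + y) powr t \<le> x powr t + y powr t"
proof -
  have "x + y \<le> (x powr t + y powr t) powr (1/t)"
    using powr_add_superadditive[of "1/t" "x powr t" "y powr t"] assms by (simp add: powr_powr)
  then have "(x + y) powr t \<le> ((x powr t + y powr t) powr (1/t)) powr t"
    using assms by (intro powr_mono2) auto
  then show ?thesis using assms by (simp add: powr_powr)
qed

lemma power_mean_le_powr_add: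
  fixes x y t :: real
  assumes "0 < t" "t \<le> 1" "0 \<le> x" "0 \<le> y"
  shows "x powr t + y powr t \<le> 2 powr (1 - t) * (x + y) powr t"
proof -
  have "(x powr t + y powr t) powr (1/t) \<le> 2 powr (1/t - 1) * (x + y)"
    using powr_add_le_power_mean[of "1/t" "x powr t" "y powr t"] assms by (simp add: powr_powr)
  then have "((x powr t + y powr t) powr (1/t)) powr t \<le> (2 powr (1/t - 1) * (x + y)) powr t"
    using assms by (intro powr_mono2) auto
  moreover have "(2 powr (1/t - 1) * (x + y)) powr t = 2 powr (1 - t) * (x + y) powr t"
    using assms by (subst powr_mult) (simp add: powr_powr left_diff_distrib)
  ultimately show ?thesis using assms by (simp add: powr_powr)
qed

lemma parallelogram_cmod:
  "(cmod (a + b))\<^sup>2 + (cmod (a - b))\<^sup>2 = 2 * ((cmod a)\<^sup>2 + (cmod b)\<^sup>2)"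
  unfolding cmod_power2 by (simp add: power2_eq_square algebra_simps)

text \<open>
  Clarkson's inequalities, in this lemma and the next, bound the norm of the Hadamard matrix on
  \<open>\<ell>\<^sub>p\<^sup>2\<close>. Both compare the \<open>p\<close>-th powers with squares and then apply the parallelogram
  law; the exponent \<open>p / 2\<close> lies on either side of 1, so the two comparisons change direction.
\<close>

lemma clarkson_ge_2:
  assumes "2 \<le> p"
  shows "cmod (a + b) powr p + cmod (a - b) powr p \<le> 2 powr (p - 1) * (cmod a powr p + cmod b powr p)"
proof -
  define t where "t = p / 2"
  have t: "1 \<le> t" using assms by (simp add: t_def)
  have sq: "cmod c powr p = ((cmod c)\<^sup>2) powr t" for c
    by (simp add: t_def powr_powr flip: powr_numeral)
  have "cmod (a + b) powr p + cmod (a - b) powr p \<le> (2 * ((cmod a)\<^sup>2 + (cmod b)\<^sup>2)) powr t"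
    unfolding sq parallelogram_cmod[symmetric] using t by (intro powr_add_superadditive) auto
  also have "\<dots> = 2 powr t * ((cmod a)\<^sup>2 + (cmod b)\<^sup>2) powr t" by (rule powr_mult)
  also have "\<dots> \<le> 2 powr t * (2 powr (t - 1) * (cmod a powr p + cmod b powr p))"
    unfolding sq using t by (intro mult_left_mono powr_add_le_power_mean) auto
  also have "\<dots> = 2 powr (p - 1) * (cmod a powr p + cmod b powr p)"
    by (simp add: t_def flip: powr_add)
  finally show ?thesis .
qed

lemma clarkson_le_2:
  assumes "1 \<le> p" "p \<le> 2"
  shows "cmod (a + b) powr p + cmod (a - b) powr p \<le> 2 * (cmod a powr p + cmod b powr p)"
proof -
  define t where "t = p / 2"
  have t: "0 < t" "t \<le> 1" using assms by (auto simp: t_def)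
  have sq: "cmod c powr p = ((cmod c)\<^sup>2) powr t" for c
    by (simp add: t_def powr_powr flip: powr_numeral)
  have "cmod (a + b) powr p + cmod (a - b) powr p
      \<le> 2 powr (1 - t) * (2 * ((cmod a)\<^sup>2 + (cmod b)\<^sup>2)) powr t"
    unfolding sq parallelogram_cmod[symmetric] using t by (intro power_mean_le_powr_add) auto
  also have "\<dots> = 2 * ((cmod a)\<^sup>2 + (cmod b)\<^sup>2) powr t"
    by (subst powr_mult[of 2]) (simp add: powr_diff)
  also have "\<dots> \<le> 2 * (cmod a powr p + cmod b powr p)"
    unfolding sq using t by (intro mult_left_mono powr_add_subadditive) auto
  finally show ?thesis .
qed

section \<open>Support functionals\<close>

text \<open>
  Up to the factor \<open>p\<close>, the gradient of \<open>a \<mapsto> \<bar>a\<bar>\<^sup>p\<close>, written as a complex linear functional.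
\<close>

definition dual_coord :: "real \<Rightarrow> complex \<Rightarrow> complex" where
  "dual_coord p a = of_real (cmod a powr (p - 2)) * cnj a"

lemma dual_coord_eq_0_iff [simp]: "dual_coord p a = 0 \<longleftrightarrow> a = 0"
  by (simp add: dual_coord_def)

lemma dual_coord_0 [simp]: "dual_coord p 0 = 0"
  by simp

lemma dual_coord_unimodular: "cmod a = 1 \<Longrightarrow> dual_coord p a = cnj a"
  by (simp add: dual_coord_def)

lemma dual_coord_mult_self: "dual_coord p a * a = of_real (cmod a powr p)"
proof (cases "a = 0")
  case False
  have "cmod a powr (p - 2) * (cmod a)\<^sup>2 = cmod a powr p"
    using False by (simp add: powr_diff)
  then show ?thesis
    unfolding dual_coord_def mult.assoc mult.commute[of "cnj a"] complex_norm_square[symmetric]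
    by (simp flip: of_real_mult of_real_power)
qed simp

text \<open>
  The inverse of \<open>a \<mapsto> \<bar>a\<bar>\<^sup>p\<^sup>-\<^sup>2 a\<^sup>*\<close> is the same map for the conjugate exponent.
\<close>

lemma dual_coord_surj:
  assumes "1 < p"
  obtains b where "dual_coord p b = v"
proof
  define q where "q = p / (p - 1)"
  show "dual_coord p (dual_coord q v) = v"
  proof (cases "v = 0")
    case False
    have nrm: "cmod (dual_coord q v) = cmod v powr (q - 1)"
      using False by (simp add: dual_coord_def norm_mult norm_divide powr_diff power2_eq_square)
    have "(q - 1) * (p - 2) + (q - 2) = 0"
      using assms by (simp add: q_def field_simps)
    then have "(cmod v powr (q - 1)) powr (p - 2) * cmod v powr (q - 2) = 1"
      using False by (simp add: powr_powr flip: powr_add)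
    then show ?thesis
      unfolding dual_coord_def[of p] nrm
      by (simp add: dual_coord_def mult.assoc[symmetric] flip: of_real_mult)
  qed simp
qed

text \<open>
  The function \<open>a \<mapsto> \<bar>a\<bar>\<^sup>p\<close> on the plane lies above its tangent plane at \<open>a\<close>, and touches it at
  \<open>a\<close> only. For \<open>a \<noteq> 0\<close> and away from the circle \<open>\<bar>a + b\<bar> = \<bar>a\<bar>\<close> this comes from
  Bernoulli's inequality for \<open>\<bar>a + b\<bar> / \<bar>a\<bar>\<close>; on the circle the tangent term is already negative.
\<close>

lemma cmod_add_powr_ge_tangent:
  assumes "1 < p"
  shows "cmod a powr p + p * Re (dual_coord p a * b) \<le> cmod (a + b) powr p"
    and "b \<noteq> 0 \<Longrightarrow> cmod a powr p + p * Re (dual_coord p a * b) < cmod (a + b) powr p"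
proof -
  have strict: "cmod a powr p + p * Re (dual_coord p a * b) < cmod (a + b) powr p" if b: "b \<noteq> 0"
  proof (cases "a = 0")
    case True
    then show ?thesis using b by simp
  next
    case False
    define r where "r = cmod a"
    define u where "u = cmod (a + b) / r"
    have r: "0 < r" using False by (simp add: r_def)
    have rr: "Re (dual_coord p a * b) = r powr p * (Re (cnj a * b) / r\<^sup>2)"
      using r by (simp add: dual_coord_def r_def powr_diff mult.assoc)
    have sq: "(cmod (a + b))\<^sup>2 = r\<^sup>2 + 2 * Re (cnj a * b) + (cmod b)\<^sup>2"
      unfolding r_def cmod_power2 by (simp add: power2_eq_square algebra_simps)
    have u2: "u\<^sup>2 = 1 + 2 * (Re (cnj a * b) / r\<^sup>2) + (cmod b)\<^sup>2 / r\<^sup>2"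
      using r by (simp add: u_def power_divide sq add_divide_distrib)
    have pos: "0 < (cmod b)\<^sup>2 / r\<^sup>2" using b r by simp
    have u0: "0 \<le> u" using r by (simp add: u_def)
    have "1 + p * (Re (cnj a * b) / r\<^sup>2) < u powr p"
    proof (cases "u = 1")
      case True
      then have "1 = 1 + 2 * (Re (cnj a * b) / r\<^sup>2) + (cmod b)\<^sup>2 / r\<^sup>2"
        using u2 by (simp only: power_one)
      then have "Re (cnj a * b) / r\<^sup>2 < 0" using pos by linarith
      then have "p * (Re (cnj a * b) / r\<^sup>2) < 0" using assms by (intro mult_pos_neg) auto
      then show ?thesis using True by simp
    next
      case False
      have rb: "Re (cnj a * b) / r\<^sup>2 \<le> u - 1"
      proof -
        have "r\<^sup>2 + Re (cnj a * b) = Re (cnj a * (a + b))"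
          unfolding r_def cmod_power2 by (simp add: power2_eq_square algebra_simps)
        also have "\<dots> \<le> r * cmod (a + b)"
          using complex_Re_le_cmod[of "cnj a * (a + b)"] by (simp add: norm_mult r_def)
        finally have "(r\<^sup>2 + Re (cnj a * b)) / r\<^sup>2 \<le> (r * cmod (a + b)) / r\<^sup>2"
          by (intro divide_right_mono) auto
        then show ?thesis using r by (simp add: u_def add_divide_distrib power2_eq_square)
      qed
      have "1 + p * (Re (cnj a * b) / r\<^sup>2) \<le> 1 + p * (u - 1)"
        using rb assms by (intro add_left_mono mult_left_mono) auto
      also have "\<dots> < u powr p" by (rule powr_gt_tangent_at_one[OF assms u0 False])
      finally show ?thesis .
    qed
    then have "r powr p * (1 + p * (Re (cnj a * b) / r\<^sup>2)) < r powr p * u powr p"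
      using r by (intro mult_strict_left_mono) auto
    then show ?thesis
      using r unfolding rr by (simp add: u_def powr_divide r_def[symmetric] algebra_simps)
  qed
  then show "b \<noteq> 0 \<Longrightarrow> cmod a powr p + p * Re (dual_coord p a * b) < cmod (a + b) powr p" .
  show "cmod a powr p + p * Re (dual_coord p a * b) \<le> cmod (a + b) powr p"
    by (cases "b = 0") (use strict in auto)
qed

lemma sum_over_two:
  fixes f :: "2 \<Rightarrow> 'a::comm_monoid_add"
  assumes "i \<noteq> j"
  shows "sum f UNIV = f i + f j"
proof -
  have U: "UNIV = {i, j}" using assms exhaust_2 by (auto simp: UNIV_2) metis+
  show ?thesis unfolding U using assms by simp
qed

lemma vec2_with_coords:
  assumes "i \<noteq> (j::2)"
  obtains z :: "'a ^ 2" where "z $ i = a" "z $ j = b"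
  using assms that[of "\<chi> l. if l = i then a else b"] by simp

text \<open>
  As a function of \<open>y\<close> this is \<open>\<parallel>w\<parallel>\<^sup>p\<^sup>-\<^sup>1\<close> times the norm-one functional that attains its norm at
  \<open>w\<close>. Without the normalisation it is a sum of terms that depend on one coordinate each.
\<close>

definition support_functional :: "real \<Rightarrow> complex ^ 2 \<Rightarrow> complex ^ 2 \<Rightarrow> complex" where
  "support_functional p w y = (\<Sum>i\<in>UNIV. dual_coord p (w $ i) * y $ i)"

lemma support_coords:
  "i \<noteq> j \<Longrightarrow>
    support_functional p w y = dual_coord p (w $ i) * y $ i + dual_coord p (w $ j) * y $ j"
  unfolding support_functional_def by (rule sum_over_two)

lemma support_add: "support_functional p w (y + z) = support_functional p w y + support_functional p w z"
  by (simp add: support_functional_def algebra_simps sum.distrib)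

lemma support_diff: "support_functional p w (y - z) = support_functional p w y - support_functional p w z"
  by (simp add: support_functional_def algebra_simps sum_subtractf)

lemma support_scale: "support_functional p w (c *s y) = c * support_functional p w y"
  by (simp add: support_functional_def sum_distrib_left algebra_simps)

lemma support_scale_left: "support_functional p (c *s w) y = dual_coord p c * support_functional p w y"
  by (simp add: support_functional_def dual_coord_def norm_mult powr_mult sum_distrib_left algebra_simps)

lemma lp_norm_sum: "lp_norm p z = (\<Sum>i\<in>UNIV. cmod (z $ i) powr p) powr (1 / p)"
  by (simp add: lp_norm_def sum_2)

lemma lp_norm_coords:
  "i \<noteq> j \<Longrightarrow> lp_norm p z = (cmod (z $ i) powr p + cmod (z $ j) powr p) powr (1 / p)"
  unfolding lp_norm_sum by (subst sum_over_two) auto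

lemma lp_norm_nonneg [simp]: "0 \<le> lp_norm p z"
  by (simp add: lp_norm_def)

lemma lp_norm_zero [simp]: "lp_norm p 0 = 0"
  by (simp add: lp_norm_def)

lemma lp_norm_eq_0_iff [simp]: "lp_norm p z = 0 \<longleftrightarrow> z = 0"
  by (auto simp: lp_norm_def add_nonneg_eq_0_iff vec_eq_iff forall_2)

lemma lp_norm_pos: "z \<noteq> 0 \<Longrightarrow> 0 < lp_norm p z"
  using lp_norm_nonneg[of p z] lp_norm_eq_0_iff[of p z] by linarith

lemma lp_norm_scale: "p \<noteq> 0 \<Longrightarrow> lp_norm p (c *s z) = cmod c * lp_norm p z"
proof -
  assume "p \<noteq> 0"
  then have "(cmod c powr p * S) powr (1 / p) = cmod c * S powr (1 / p)" for S
    by (simp add: powr_mult powr_powr)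
  then show ?thesis
    by (simp add: lp_norm_sum norm_mult powr_mult flip: sum_distrib_left)
qed

lemma support_self:
  assumes "p \<noteq> 0"
  shows "support_functional p w w = of_real (lp_norm p w powr p)"
  using assms by (simp add: support_functional_def lp_norm_sum dual_coord_mult_self powr_powr sum_nonneg)

lemma support_self_ne_0: "w \<noteq> 0 \<Longrightarrow> p \<noteq> 0 \<Longrightarrow> support_functional p w w \<noteq> 0"
  by (simp add: support_self)

text \<open>
  A zero of the support functional of \<open>w\<close> is a direction to which \<open>w\<close> is Birkhoff-James
  orthogonal, and strict convexity makes \<open>w\<close> the only point of least norm on the line. Adding
  up the tangent inequalities of the coordinates gives both.
\<close>

lemma lp_norm_le_add_of_support_eq_0:
  assumes p: "1 < p" and y: "support_functional p w y = 0"
  shows "lp_norm p w \<le> lp_norm p (w + y)"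
    and "y \<noteq> 0 \<Longrightarrow> lp_norm p w < lp_norm p (w + y)"
proof -
  let ?t = "\<lambda>i. cmod (w $ i) powr p + p * Re (dual_coord p (w $ i) * y $ i)"
  have "Re (support_functional p w y) = 0" using y by simp
  then have sum: "(\<Sum>i\<in>UNIV. cmod (w $ i) powr p) = (\<Sum>i\<in>UNIV. ?t i)"
    by (simp add: support_functional_def sum.distrib flip: sum_distrib_left)
  have nonneg: "0 \<le> (\<Sum>i\<in>UNIV. ?t i)" unfolding sum[symmetric] by (simp add: sum_nonneg)
  have le: "?t i \<le> cmod ((w + y) $ i) powr p" for i
    using cmod_add_powr_ge_tangent(1)[OF p, of "w $ i" "y $ i"] by simp
  show "lp_norm p w \<le> lp_norm p (w + y)"
    unfolding lp_norm_sum sum using p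
    by (intro powr_mono2 sum_mono le nonneg) simp
  assume "y \<noteq> 0"
  then obtain i where "y $ i \<noteq> 0" by (auto simp: vec_eq_iff)
  then have "?t i < cmod ((w + y) $ i) powr p"
    using cmod_add_powr_ge_tangent(2)[OF p, of "y $ i" "w $ i"] by simp
  then have "(\<Sum>i\<in>UNIV. ?t i) < (\<Sum>i\<in>UNIV. cmod ((w + y) $ i) powr p)"
    using le by (intro sum_strict_mono_ex1) auto
  then show "lp_norm p w < lp_norm p (w + y)"
    unfolding lp_norm_sum sum using p
    by (intro powr_less_mono2 nonneg) auto
qed

text \<open>
  Hoelder's inequality. For \<open>J = support_functional p w\<close>, the vectors \<open>J w *s z\<close> and \<open>J z *s w\<close>
  differ by a zero of \<open>J\<close>, so the previous lemma compares their norms.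
\<close>

lemma cmod_support_le:
  assumes p: "1 < p"
  shows "cmod (support_functional p w z) * lp_norm p w \<le> lp_norm p w powr p * lp_norm p z"
proof -
  define s where "s = support_functional p w w"
  have "cmod (support_functional p w z) * lp_norm p w = lp_norm p (support_functional p w z *s w)"
    using p by (simp add: lp_norm_scale)
  also have "\<dots> \<le> lp_norm p (s *s z)"
  proof -
    have "support_functional p (support_functional p w z *s w) (s *s z - support_functional p w z *s w) = 0"
      by (simp add: support_scale_left support_diff support_scale s_def)
    from lp_norm_le_add_of_support_eq_0(1)[OF p this] show ?thesis by simp
  qed
  also have "\<dots> = lp_norm p w powr p * lp_norm p z"
    using p by (simp add: s_def lp_norm_scale support_self)
  finally show ?thesis .
qed

lemma support_kernel_line:
  assumes "u \<noteq> 0" "w \<noteq> 0" "support_functional p u v = 0" "support_functional p u w = 0"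
  obtains m where "v = m *s w"
proof -
  obtain i where i: "w $ i \<noteq> 0" using assms(2) by (auto simp: vec_eq_iff)
  define j where "j = i + 1"
  have ij: "i \<noteq> j" by (simp add: j_def)
  have all: "(\<forall>l. P l) \<longleftrightarrow> P i \<and> P j" for P
    using ij by (metis exhaust_2)
  define \<alpha> \<beta> where "\<alpha> = dual_coord p (u $ i)" and "\<beta> = dual_coord p (u $ j)"
  have v: "\<alpha> * v $ i + \<beta> * v $ j = 0" and w: "\<alpha> * w $ i + \<beta> * w $ j = 0"
    using assms(3,4) support_coords[OF ij] by (auto simp: \<alpha>_def \<beta>_def)
  have "u $ i \<noteq> 0 \<or> u $ j \<noteq> 0" using assms(1) by (simp add: vec_eq_iff all)
  then have "\<beta> \<noteq> 0" using w i by (auto simp: \<alpha>_def \<beta>_def)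
  have "\<beta> * (v $ j * w $ i) = \<beta> * (v $ i * w $ j)"
  proof -
    have "\<beta> * v $ j = - \<alpha> * v $ i" "\<beta> * w $ j = - \<alpha> * w $ i"
      using v w by (simp_all add: add_eq_0_iff)
    then have "(\<beta> * v $ j) * w $ i = v $ i * (\<beta> * w $ j)" by simp
    then show ?thesis by (simp add: algebra_simps)
  qed
  then have "v $ j * w $ i = v $ i * w $ j" using \<open>\<beta> \<noteq> 0\<close> by simp
  then have "v = (v $ i / w $ i) *s w" using i by (simp add: vec_eq_iff all field_simps)
  then show ?thesis using that by blast
qed

lemma orthogonal_vector:
  assumes p: "1 < p" and "i \<noteq> j"
  obtains y where "dual_coord p (y $ i) = w $ j" "dual_coord p (y $ j) = - w $ i"
    "support_functional p y w = 0"
proof -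
  obtain a where a: "dual_coord p a = w $ j" by (rule dual_coord_surj[OF p])
  obtain b where b: "dual_coord p b = - w $ i" by (rule dual_coord_surj[OF p])
  define y :: "complex ^ 2" where "y = (\<chi> k. if k = i then a else b)"
  have "y $ i = a" "y $ j = b" using assms by (auto simp: y_def)
  with a b show ?thesis using that[of y] support_coords[OF assms(2), of p y w] by simp
qed

section \<open>Operators\<close>

abbreviation clinear2 :: "(complex ^ 2 \<Rightarrow> complex ^ 2) \<Rightarrow> bool" where
  "clinear2 \<equiv> Vector_Spaces.linear (*s) (*s)"

lemma clinear2_iff:
  "clinear2 T \<longleftrightarrow> (\<forall>x y. T (x + y) = T x + T y) \<and> (\<forall>c x. T (c *s x) = c *s T x)"
  by (simp add: Vector_Spaces.linear_iff vec.vector_space_axioms)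

lemma clinear2_coords:
  assumes "clinear2 T" "i \<noteq> j"
  shows "T z = z $ i *s T (axis i 1) + z $ j *s T (axis j 1)"
proof -
  have "z = z $ i *s axis i 1 + z $ j *s axis j 1"
    unfolding vec_eq_iff using assms(2) exhaust_2 by (auto simp: axis_def) metis+
  then have "T z = T (z $ i *s axis i 1 + z $ j *s axis j 1)" by simp
  then show ?thesis using assms(1) by (simp add: clinear2_iff)
qed

lemma continuous_on_lp_norm_clinear2:
  assumes "0 < p" "clinear2 T"
  shows "continuous_on S (\<lambda>z. lp_norm p (T z))"
proof -
  define a b where "a = T (axis 1 1)" and "b = T (axis 2 1)"
  have "lp_norm p (T z) = lp_norm p (z $ 1 *s a + z $ 2 *s b)" for z
    using clinear2_coords[OF assms(2), of 1 2 z] by (simp add: a_def b_def)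
  moreover have coord: "continuous_on S (\<lambda>z. cmod (z $ 1 * c + z $ 2 * d) powr p)" for c d
    by (rule continuous_on_powr') (use assms(1) in \<open>auto intro!: continuous_intros\<close>)
  have "continuous_on S (\<lambda>z. lp_norm p (z $ 1 *s a + z $ 2 *s b))"
    unfolding lp_norm_def vector_add_component vector_smult_component
    by (rule continuous_on_powr'[OF continuous_on_add[OF coord coord]]) (use assms(1) in auto)
  ultimately show ?thesis by simp
qed

lemma compact_lp_sphere:
  assumes "0 < p"
  shows "compact {z. lp_norm p z = 1}"
  unfolding compact_eq_bounded_closed
proof
  have "norm z \<le> 2" if "lp_norm p z = 1" for z
  proof -
    have "((cmod (z $ 1) powr p + cmod (z $ 2) powr p) powr (1 / p)) powr p = 1"
      using that by (simp add: lp_norm_def)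
    then have s: "cmod (z $ 1) powr p + cmod (z $ 2) powr p = 1"
      using assms by (simp add: powr_powr)
    have "cmod (z $ i) \<le> 1" for i
    proof (rule ccontr)
      assume "\<not> cmod (z $ i) \<le> 1"
      then have "1 powr p < cmod (z $ i) powr p" using assms by (intro powr_less_mono2) auto
      moreover have "cmod (z $ i) powr p \<le> 1"
        using s exhaust_2[of i] by (smt (verit) powr_ge_zero)
      ultimately show False by simp
    qed
    then have "(\<Sum>i\<in>UNIV. norm (z $ i)) \<le> 2" 
      unfolding sum_2 using add_mono[of "cmod (z $ 1)" 1 "cmod (z $ 2)" 1] by simp
    moreover have "norm z \<le> (\<Sum>i\<in>UNIV. norm (z $ i))"
      unfolding norm_vec_def by (rule L2_set_le_sum) simp
    ultimately show ?thesis by simp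
  qed
  then show "bounded {z. lp_norm p z = 1}" by (auto intro: boundedI)
  have "clinear2 (\<lambda>z. z)" by (simp add: clinear2_iff)
  from continuous_closed_preimage[OF continuous_on_lp_norm_clinear2[OF assms this] closed_UNIV closed_singleton, of 1]
  show "closed {z. lp_norm p z = 1}" by (simp add: vimage_def)
qed

text \<open>
  Finite dimension enters here: the unit sphere is compact, so every linear map is bounded and
  attains its norm.
\<close>

lemma clinear2_attains_op_norm:
  assumes "0 < p" "clinear2 T"
  obtains x where "lp_norm p x = 1" "op_norm p T = lp_norm p (T x)"
    "\<And>v. lp_norm p (T v) \<le> lp_norm p (T x) * lp_norm p v"
proof -
  have "lp_norm p (axis 1 1) = 1" by (simp add: lp_norm_def axis_def)
  then have "{z. lp_norm p z = 1} \<noteq> {}" by blast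
  from continuous_attains_sup[OF compact_lp_sphere[OF assms(1)] this
      continuous_on_lp_norm_clinear2[OF assms]]
  obtain x where x: "lp_norm p x = 1"
    and max: "\<And>v. lp_norm p v = 1 \<Longrightarrow> lp_norm p (T v) \<le> lp_norm p (T x)" by auto
  have "lp_norm p (T v) \<le> lp_norm p (T x) * lp_norm p v" for v
  proof (cases "v = 0")
    case True
    have "T (0 *s v) = 0 *s T v" using assms(2) unfolding clinear2_iff by blast
    then have "T v = 0" using True by simp
    then show ?thesis by simp
  next
    case False
    define n where "n = lp_norm p v"
    have n: "0 < n" using False by (simp add: n_def lp_norm_pos)
    let ?u = "complex_of_real (1 / n) *s v"
    have "lp_norm p ?u = 1"
      using n assms(1) by (simp add: lp_norm_scale norm_divide del: lp_norm_eq_0_iff flip: n_def)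
    from max[OF this] have "lp_norm p (complex_of_real (1 / n) *s T v) \<le> lp_norm p (T x)"
      using assms(2) by (simp add: clinear2_iff)
    then have "lp_norm p (T v) / n \<le> lp_norm p (T x)"
      using n assms(1) by (simp add: lp_norm_scale norm_divide del: lp_norm_eq_0_iff)
    then show ?thesis using n by (simp add: pos_divide_le_eq flip: n_def)
  qed
  moreover have "op_norm p T = lp_norm p (T x)"
    unfolding op_norm_def using x max by (intro cSup_eq_maximum) auto
  ultimately show ?thesis using that x by blast
qed

lemma operators_eq_clinear2:
  assumes "0 < p"
  shows "operators p = {T. clinear2 T}"
  using clinear2_attains_op_norm[OF assms] unfolding operators_def by blast

lemma lp_norm_le_op_norm:
  assumes "0 < p" "clinear2 T"
  shows "lp_norm p (T v) \<le> op_norm p T * lp_norm p v"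
  by (rule clinear2_attains_op_norm[OF assms, of ?thesis]) simp

section \<open>A criterion for failure of left symmetry\<close>

text \<open>
  Take \<open>A = B - c T\<close>. Then \<open>A x\<close> is a zero of the support functional of \<open>T x\<close>, and \<open>x\<close> is a
  norming vector of \<open>T\<close>, so \<open>T\<close> is orthogonal to \<open>A\<close>. On the other hand \<open>A + c T = B\<close> has norm
  at most \<open>K\<close>, whereas the vector \<open>z\<close> shows that the norm of \<open>A\<close> exceeds \<open>K\<close>.
\<close>

lemma not_left_symmetricI:
  assumes p: "1 < p" and T: "clinear2 T" and B: "clinear2 B"
    and x: "lp_norm p x = 1" "op_norm p T = lp_norm p (T x)"
    and K: "\<And>v. lp_norm p (B v) \<le> K * lp_norm p v"
    and c: "support_functional p (T x) (B x) = c * support_functional p (T x) (T x)"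
    and z: "K * lp_norm p z < lp_norm p (B z - c *s T z)"
  shows "\<not> left_symmetric p T"
proof
  assume sym: "left_symmetric p T"
  define A where "A = (\<lambda>v. B v - c *s T v)"
  have A: "clinear2 A" using T B by (simp add: A_def clinear2_iff algebra_simps)
  have "bj_orthogonal p T A"
    unfolding bj_orthogonal_def
  proof
    fix d
    have lin: "clinear2 (\<lambda>v. T v + d *s A v)" using T A by (simp add: clinear2_iff algebra_simps)
    have "support_functional p (T x) (d *s A x) = 0"
      by (simp add: A_def support_scale support_diff c)
    then have "lp_norm p (T x) \<le> lp_norm p (T x + d *s A x)"
      by (rule lp_norm_le_add_of_support_eq_0(1)[OF p])
    also have "\<dots> \<le> op_norm p (\<lambda>v. T v + d *s A v)"
      using lp_norm_le_op_norm[OF _ lin, of p x] p x by simp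
    finally show "op_norm p T \<le> op_norm p (\<lambda>v. T v + d *s A v)" using x by simp
  qed
  moreover have "A \<in> operators p" using A p by (simp add: operators_eq_clinear2)
  ultimately have "bj_orthogonal p A T" using sym by (simp add: left_symmetric_def)
  then have "op_norm p A \<le> op_norm p (\<lambda>v. A v + c *s T v)" by (simp add: bj_orthogonal_def)
  also have "(\<lambda>v. A v + c *s T v) = B" by (simp add: A_def)
  also have "op_norm p B \<le> K"
  proof -
    obtain u where "lp_norm p u = 1" "op_norm p B = lp_norm p (B u)"
      using clinear2_attains_op_norm[of p B] p B by auto
    then show ?thesis using K[of u] by simp
  qed
  finally have "op_norm p A * lp_norm p z \<le> K * lp_norm p z" by (intro mult_right_mono) auto
  then show False using z lp_norm_le_op_norm[OF _ A, of p z] p by (simp add: A_def)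
qed

text \<open>
  The form of the criterion in which no norm of \<open>B - c T\<close> has to be computed: at a norming vector
  \<open>z\<close> of \<open>B\<close> where \<open>B z\<close> is orthogonal to \<open>T z\<close>, subtracting a nonzero multiple of \<open>T\<close> makes
  the value longer.
\<close>

lemma not_left_symmetricI_support:
  assumes p: "1 < p" and T: "clinear2 T" and B: "clinear2 B"
    and x: "lp_norm p x = 1" "op_norm p T = lp_norm p (T x)"
    and K: "\<And>v. lp_norm p (B v) \<le> K * lp_norm p v" "lp_norm p (B z) = K * lp_norm p z"
    and Bx: "support_functional p (T x) (B x) \<noteq> 0"
    and Tz: "T z \<noteq> 0" "support_functional p (B z) (T z) = 0"
  shows "\<not> left_symmetric p T"
proof -
  have "T x \<noteq> 0" using Bx by (auto simp: support_functional_def)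
  define c where "c = support_functional p (T x) (B x) / support_functional p (T x) (T x)"
  have c: "support_functional p (T x) (B x) = c * support_functional p (T x) (T x)"
    using p \<open>T x \<noteq> 0\<close> by (simp add: c_def support_self_ne_0)
  have "support_functional p (B z) ((- c) *s T z) = 0"
    unfolding support_scale using Tz by simp
  moreover have "(- c) *s T z \<noteq> 0" using Tz c Bx by (auto simp: vec_eq_iff)
  ultimately have "lp_norm p (B z) < lp_norm p (B z + (- c) *s T z)"
    by (rule lp_norm_le_add_of_support_eq_0(2)[OF p])
  also have "B z + (- c) *s T z = B z - c *s T z" by (simp add: vec_eq_iff)
  finally show ?thesis using K(2) by (intro not_left_symmetricI[OF p T B x K(1) c]) simp
qed

section \<open>Rank-one test operators\<close>

text \<open>
  For \<open>B\<close> one takes the rank-one operator \<open>v \<mapsto> support_functional p z v *s b\<close>, which attains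
  its norm at \<open>z\<close>, with \<open>b\<close> orthogonal to \<open>T z\<close>. The criterion then asks that \<open>z\<close> is not
  orthogonal to \<open>x\<close> and \<open>T x\<close> is not orthogonal to \<open>b\<close>. Now \<open>T x\<close> is orthogonal exactly to the multiples of
  \<open>u\<close>, so the second condition holds once \<open>u\<close> is not orthogonal to \<open>T z\<close>. The first condition
  leaves at least two linearly independent choices for \<open>z\<close>, and not all of them
  are sent by \<open>T\<close> into the kernel of the support functional of \<open>u\<close>.
\<close>

lemma not_left_symmetric_of_asymmetric_range:
  assumes p: "1 < p" and T: "clinear2 T"
    and x: "lp_norm p x = 1" "op_norm p T = lp_norm p (T x)" and Tx: "T x \<noteq> 0"
    and u: "support_functional p (T x) u = 0" and v: "support_functional p u (T v) \<noteq> 0"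
  shows "\<not> left_symmetric p T"
proof -
  have "x \<noteq> 0" using x by auto
  then obtain k where k: "x $ k \<noteq> 0" by (auto simp: vec_eq_iff)
  define j where "j = k + 1"
  have kj: "k \<noteq> j" by (simp add: j_def)
  obtain \<tau> :: complex where \<tau>: "\<tau> = 1 \<or> \<tau> = -1" "x $ k + \<tau> * x $ j \<noteq> 0"
  proof (cases "x $ k + x $ j = 0")
    case True
    then have "x $ k + (-1) * x $ j = 2 * x $ k" by (simp add: add_eq_0_iff)
    then show ?thesis using k that[of "-1"] by simp
  next
    case False
    then show ?thesis using that[of 1] by simp
  qed
  \<comment> \<open>At vectors with coordinates of modulus 0 or 1 the support functional does not depend on \<open>p\<close>.\<close>
  define e e' where "e = (axis k 1 :: complex ^ 2)" and "e' = axis k 1 + \<tau> *s axis j 1"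
  have "support_functional p e x \<noteq> 0"
    using k kj unfolding support_coords[OF kj] by (simp add: e_def axis_def dual_coord_unimodular)
  moreover have "support_functional p e' x \<noteq> 0"
    using kj \<tau> unfolding support_coords[OF kj] by (auto simp: e'_def axis_def dual_coord_unimodular)
  moreover have "support_functional p u (T e) \<noteq> 0 \<or> support_functional p u (T e') \<noteq> 0"
  proof (rule ccontr)
    assume "\<not> ?thesis"
    then have *: "support_functional p u (T (axis k 1)) = 0"
      "support_functional p u (T (axis k 1 + \<tau> *s axis j 1)) = 0"
      by (auto simp: e_def e'_def)
    moreover have "T (axis k 1 + \<tau> *s axis j 1) = T (axis k 1) + \<tau> *s T (axis j 1)"
      using T by (simp add: clinear2_iff)
    ultimately have "support_functional p u (T (axis j 1)) = 0"
      using \<tau>(1) by (auto simp: support_add support_scale)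
    then show False
      using v * clinear2_coords[OF T kj, of v] by (simp add: support_add support_scale)
  qed
  ultimately obtain z where z: "support_functional p z x \<noteq> 0" "support_functional p u (T z) \<noteq> 0" by blast
  have Tz: "T z \<noteq> 0" using z by (auto simp: support_functional_def)
  obtain b where b: "dual_coord p (b $ 1) = T z $ 2" "dual_coord p (b $ 2) = - T z $ 1"
      "support_functional p b (T z) = 0"
    by (rule orthogonal_vector[OF p, of 1 2 "T z"]) auto
  have b0: "b \<noteq> 0" using b Tz by (auto simp: vec_eq_iff forall_2)
  have Txb: "support_functional p (T x) b \<noteq> 0"
  proof
    assume "support_functional p (T x) b = 0"
    then obtain m where "u = m *s b" using support_kernel_line[OF Tx b0 u] by blast
    then show False using z b by (simp add: support_scale_left)
  qed
  define B where "B = (\<lambda>v. support_functional p z v *s b)"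
  define n where "n = lp_norm p z"
  have "z \<noteq> 0" using z by (auto simp: support_functional_def)
  then have n: "0 < n" by (simp add: n_def lp_norm_pos)
  show ?thesis
  proof (rule not_left_symmetricI_support[OF p T _ x])
    show "clinear2 B"
      by (simp add: B_def clinear2_iff support_add support_scale vec.scale_left_distrib)
    show "lp_norm p (B v) \<le> (n powr p / n * lp_norm p b) * lp_norm p v" for v
    proof -
      have "cmod (support_functional p z v) \<le> n powr p * lp_norm p v / n"
        using cmod_support_le[OF p, of z v] n by (simp add: pos_le_divide_eq flip: n_def)
      then have "cmod (support_functional p z v) * lp_norm p b \<le> (n powr p * lp_norm p v / n) * lp_norm p b"
        by (rule mult_right_mono) simp
      then show ?thesis using p by (simp add: B_def lp_norm_scale algebra_simps)
    qed
    show "lp_norm p (B z) = (n powr p / n * lp_norm p b) * lp_norm p z"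
      using p n by (simp add: B_def lp_norm_scale support_self flip: n_def)
    show "support_functional p (T x) (B x) \<noteq> 0" using z Txb by (simp add: B_def support_scale)
    show "T z \<noteq> 0" by (rule Tz)
    show "support_functional p (B z) (T z) = 0" using b by (simp add: B_def support_scale_left)
  qed
qed

section \<open>Operators of rank one\<close>

text \<open>
  Each of the two affine functions of \<open>\<alpha>\<close> has at most one zero, so one of three candidates
  avoids both.
\<close>

lemma unimodular_avoiding_zeros:
  fixes P Q R S :: complex
  assumes "P \<noteq> 0 \<or> Q \<noteq> 0" "R \<noteq> 0 \<or> S \<noteq> 0"
  obtains \<alpha> where "cmod \<alpha> = 1" "P + \<alpha> * Q \<noteq> 0" "R + \<alpha> * S \<noteq> 0"
proof -
  have unique: "\<alpha> = \<beta>" if "a \<noteq> 0 \<or> b \<noteq> 0" "a + \<alpha> * b = 0" "a + \<beta> * b = 0" for a b \<alpha> \<beta> :: complex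
  proof -
    have "(\<alpha> - \<beta>) * b = 0" using that by (simp add: algebra_simps add_eq_0_iff)
    then show ?thesis using that by auto
  qed
  define f g where "f = (\<lambda>\<alpha>. P + \<alpha> * Q = 0)" and "g = (\<lambda>\<alpha>. R + \<alpha> * S = 0)"
  have f: "\<alpha> = \<beta>" if "f \<alpha>" "f \<beta>" for \<alpha> \<beta>
    using unique[OF assms(1)] that unfolding f_def by blast
  have g: "\<alpha> = \<beta>" if "g \<alpha>" "g \<beta>" for \<alpha> \<beta>
    using unique[OF assms(2)] that unfolding g_def by blast
  have "\<i> \<noteq> 1" "\<i> \<noteq> -1" "(1::complex) \<noteq> -1" by (auto simp: complex_eq_iff)
  then have "\<exists>\<alpha>\<in>{1, -1, \<i>}. \<not> f \<alpha> \<and> \<not> g \<alpha>"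
    using f[of 1 "-1"] f[of \<i> 1] f[of \<i> "-1"] g[of 1 "-1"] g[of \<i> 1] g[of \<i> "-1"] by blast
  then obtain \<alpha> where "\<alpha> \<in> {1, -1, \<i>}" "\<not> f \<alpha>" "\<not> g \<alpha>" by blast
  then show ?thesis using that[of \<alpha>] by (auto simp: f_def g_def)
qed

text \<open>
  For \<open>T\<close> of rank one with range spanned by \<open>w = T x\<close>, the operator \<open>B\<close> can be a monomial
  isometry: every vector is norming for it, so \<open>z\<close> may be the preimage of a vector \<open>y\<close> orthogonal
  to \<open>w\<close>. The free phase \<open>\<alpha>\<close> makes the two remaining expressions nonzero, provided that neither
  vanishes identically in \<open>\<alpha>\<close>; the hypotheses \<open>ne\<close> ensure this.
\<close>

lemma not_left_symmetric_rank_one: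
  assumes p: "1 < p" and T: "clinear2 T"
    and x: "lp_norm p x = 1" "op_norm p T = lp_norm p (T x)"
    and ij: "i \<noteq> j" and kl: "k \<noteq> l"
    and rank1: "\<And>v. T v = (\<gamma> k * v $ k + \<gamma> l * v $ l) *s T x"
    and ne: "T x $ i \<noteq> 0" "x $ k \<noteq> 0" "\<gamma> l \<noteq> 0 \<or> \<gamma> k \<noteq> 0 \<and> T x $ j \<noteq> 0"
  shows "\<not> left_symmetric p T"
proof -
  define w where "w = T x"
  have all: "(\<forall>m. P m) \<longleftrightarrow> P i \<and> P j" for P
    using ij by (metis exhaust_2)
  obtain y where y: "dual_coord p (y $ i) = w $ j" "dual_coord p (y $ j) = - w $ i"
      "support_functional p y w = 0"
    by (rule orthogonal_vector[OF p ij])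
  have "y $ j \<noteq> 0" "w $ j \<noteq> 0 \<Longrightarrow> y $ i \<noteq> 0" using y ne(1) by (auto simp: w_def)
  then have ne': "\<gamma> l * y $ j \<noteq> 0 \<or> \<gamma> k * y $ i \<noteq> 0" using ne(3) by (auto simp: w_def)
  have ne'': "dual_coord p (w $ i) * x $ k \<noteq> 0 \<or> dual_coord p (w $ j) * x $ l \<noteq> 0"
    using ne by (simp add: w_def)
  obtain \<alpha> where \<alpha>: "cmod \<alpha> = 1"
      "dual_coord p (w $ i) * x $ k + \<alpha> * (dual_coord p (w $ j) * x $ l) \<noteq> 0"
      "\<gamma> l * y $ j + \<alpha> * (\<gamma> k * y $ i) \<noteq> 0"
    by (rule unimodular_avoiding_zeros[OF ne'' ne'])
  define B :: "complex ^ 2 \<Rightarrow> complex ^ 2"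
    where "B v = (\<chi> m. if m = i then v $ k else \<alpha> * v $ l)" for v
  have Bi: "B v $ i = v $ k" and Bj: "B v $ j = \<alpha> * v $ l" for v
    using ij by (auto simp: B_def)
  obtain z :: "complex ^ 2" where z: "z $ k = y $ i" "z $ l = y $ j / \<alpha>"
    by (rule vec2_with_coords[OF kl])
  have "\<alpha> \<noteq> 0" using \<alpha>(1) by auto
  then have Bz: "B z = y" by (simp add: vec_eq_iff all Bi Bj z)
  show ?thesis
  proof (rule not_left_symmetricI_support[OF p T _ x])
    show "clinear2 B" by (simp add: clinear2_iff vec_eq_iff all Bi Bj algebra_simps)
    show "lp_norm p (B v) \<le> 1 * lp_norm p v" "lp_norm p (B z) = 1 * lp_norm p z" for v
      unfolding lp_norm_coords[OF ij, of p "B _"] lp_norm_coords[OF kl, of p v] lp_norm_coords[OF kl, of p z]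
      using \<alpha>(1) by (auto simp: Bi Bj norm_mult)
    show "support_functional p (T x) (B x) \<noteq> 0"
      using \<alpha>(2) unfolding support_coords[OF ij] by (simp add: Bi Bj w_def algebra_simps)
    have "\<alpha> * (\<gamma> k * z $ k + \<gamma> l * z $ l) = \<gamma> l * y $ j + \<alpha> * (\<gamma> k * y $ i)"
      using \<open>\<alpha> \<noteq> 0\<close> by (simp add: z field_simps)
    then have "\<gamma> k * z $ k + \<gamma> l * z $ l \<noteq> 0" using \<alpha>(3) by auto
    then show "T z \<noteq> 0"
      unfolding rank1[of z] using ne(1) by (simp only: vec.scale_eq_0_iff) auto
    show "support_functional p (B z) (T z) = 0"
      using y(3) by (subst rank1) (simp only: Bz support_scale w_def mult_zero_right)
  qed
qed

text \<open>
  The number \<open>C\<close> bounds the \<open>p\<close>-th power of the norm of the matrix with rows \<open>(1, 1)\<close> and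
  \<open>(1, -1)\<close>, and \<open>(s, t)\<close> is a vector where the matrix with rows \<open>(0, 1)\<close> and \<open>(1, -1)\<close>
  exceeds that bound. For \<open>p \<ge> 2\<close> the Hadamard matrix attains its norm at \<open>(1, -1)\<close>, where its
  first coordinate vanishes, so that removing an entry of the first row lengthens the value at
  once. For \<open>p < 2\<close> the norm is attained at \<open>(0, 1)\<close> and the two matrices agree there; a small step to \<open>(-r, 1)\<close> gains a term of first order in \<open>r\<close> at a
  cost of order \<open>r\<^sup>p\<close>.
\<close>

lemma sum_difference_gap:
  assumes p: "1 < p"
  obtains C and s t :: complex where "0 \<le> C"
    "\<And>a b. cmod (a + b) powr p + cmod (a - b) powr p \<le> C * (cmod a powr p + cmod b powr p)"
    "C * (cmod s powr p + cmod t powr p) < cmod t powr p + cmod (s - t) powr p"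
proof (cases "2 \<le> p")
  case True
  have "2 powr (p - 1) * (cmod 1 powr p + cmod (-1) powr p) < cmod (-1) powr p + cmod (1 - (-1)) powr p"
    by (simp add: powr_diff)
  then show ?thesis by (rule that[rotated 2]) (use clarkson_ge_2[OF True] in auto)
next
  case False
  \<comment> \<open>With this \<open>r\<close> the cost \<open>2 r\<^sup>p\<close> equals \<open>r\<close>, which is less than the gain \<open>p r\<close>.\<close>
  define r where "r = (1/2::real) powr (1 / (p - 1))"
  have r: "0 < r" by (simp add: r_def)
  have "r powr (p - 1) = 1/2" using p by (simp add: r_def powr_powr)
  then have "2 * r powr p = r" using r by (simp add: powr_diff field_simps)
  then have "2 * (r powr p + 1) < 2 + p * r" using p r by simp
  also have "2 + p * r < 1 + (1 + r) powr p"
    using powr_gt_tangent_at_one[OF p, of "1 + r"] r by simp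
  finally have *: "2 * (r powr p + 1) < 1 + (1 + r) powr p" .
  have "2 * (cmod (- of_real r) powr p + cmod 1 powr p)
      < cmod 1 powr p + cmod (- of_real r - 1) powr p"
  proof -
    have "cmod (- of_real r - 1) = 1 + r"
      using r norm_of_real[of "- r - 1", where 'a = complex] by simp
    then show ?thesis using * r by simp
  qed
  then show ?thesis by (rule that[rotated 2]) (use clarkson_le_2 p False in auto)
qed

text \<open>
  Multiples of matrix units escape the argument by monomial isometries. Here \<open>B\<close> is
  \<open>\<tau>\<close> times a Hadamard matrix and \<open>B - T\<close> is that matrix with one entry removed.
\<close>

lemma not_left_symmetric_matrix_unit:
  assumes p: "1 < p" and T: "clinear2 T"
    and x: "lp_norm p x = 1" "op_norm p T = lp_norm p (T x)"
    and ij: "i \<noteq> j" and kl: "k \<noteq> l"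
    and unit: "\<And>v. T v $ i = \<tau> * v $ k" "\<And>v. T v $ j = 0"
    and xl: "x $ l = 0" and \<tau>: "\<tau> \<noteq> 0"
  shows "\<not> left_symmetric p T"
proof -
  have all: "(\<forall>m. P m) \<longleftrightarrow> P i \<and> P j" for P
    using ij by (metis exhaust_2)
  obtain C s t where C: "0 \<le> C"
      "\<And>a b. cmod (a + b) powr p + cmod (a - b) powr p \<le> C * (cmod a powr p + cmod b powr p)"
      "C * (cmod s powr p + cmod t powr p) < cmod t powr p + cmod (s - t) powr p"
    by (rule sum_difference_gap[OF p]) blast
  define B :: "complex ^ 2 \<Rightarrow> complex ^ 2"
    where "B v = (\<chi> m. if m = i then \<tau> * (v $ k + v $ l) else \<tau> * (v $ k - v $ l))" for v
  have Bi: "B v $ i = \<tau> * (v $ k + v $ l)" and Bj: "B v $ j = \<tau> * (v $ k - v $ l)" for v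
    using ij by (auto simp: B_def)
  obtain z :: "complex ^ 2" where z: "z $ k = s" "z $ l = t"
    by (rule vec2_with_coords[OF kl])
  have root: "cmod \<tau> * S powr (1 / p) = (cmod \<tau> powr p * S) powr (1 / p)" for S
    using p by (simp add: powr_mult powr_powr)
  define K where "K = cmod \<tau> * C powr (1 / p)"
  have K: "K * lp_norm p v = (cmod \<tau> powr p * (C * (cmod (v $ k) powr p + cmod (v $ l) powr p))) powr (1 / p)" for v
    unfolding root[symmetric] lp_norm_coords[OF kl] K_def by (simp add: powr_mult)
  show ?thesis
  proof (rule not_left_symmetricI[OF p T _ x])
    show "clinear2 B" by (simp add: clinear2_iff vec_eq_iff all Bi Bj algebra_simps)
    show "lp_norm p (B v) \<le> K * lp_norm p v" for v
    proof -
      have "cmod \<tau> powr p * (cmod (v $ k + v $ l) powr p + cmod (v $ k - v $ l) powr p)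
          \<le> cmod \<tau> powr p * (C * (cmod (v $ k) powr p + cmod (v $ l) powr p))"
        by (intro mult_left_mono C) simp
      then show ?thesis
        unfolding K lp_norm_coords[OF ij, of p "B v"] Bi Bj norm_mult
          powr_mult[of "cmod \<tau>"] distrib_left[symmetric]
        using p by (intro powr_mono2) auto
    qed
    show "support_functional p (T x) (B x) = 1 * support_functional p (T x) (T x)"
      unfolding support_coords[OF ij] by (simp add: Bi Bj unit xl)
    have "(B z - 1 *s T z) $ i = \<tau> * t" "(B z - 1 *s T z) $ j = \<tau> * (s - t)"
      by (simp_all add: Bi Bj unit z algebra_simps)
    then have "lp_norm p (B z - 1 *s T z) = (cmod \<tau> powr p * (cmod t powr p + cmod (s - t) powr p)) powr (1 / p)"
      unfolding lp_norm_coords[OF ij] by (simp only: norm_mult powr_mult[of "cmod \<tau>"] distrib_left)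
    moreover have "cmod \<tau> powr p * (C * (cmod s powr p + cmod t powr p))
        < cmod \<tau> powr p * (cmod t powr p + cmod (s - t) powr p)"
      using \<tau> C(3) by (intro mult_strict_left_mono) auto
    ultimately show "K * lp_norm p z < lp_norm p (B z - 1 *s T z)"
      unfolding K z using p C(1) by (simp only:) (intro powr_less_mono2, auto)
  qed
qed

section \<open>Left symmetric operators\<close>

theorem theorem2p14:
  fixes p :: real and T :: "complex ^ 2 \<Rightarrow> complex ^ 2"
  assumes "1 < p" and "T \<in> operators p"
  shows "left_symmetric p T \<longleftrightarrow> T = (\<lambda>z. 0)"
proof
  assume "T = (\<lambda>z. 0)"
  then show "left_symmetric p T" by (simp add: left_symmetric_def bj_orthogonal_def)
next
  assume sym: "left_symmetric p T"
  have p: "1 < p" by fact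
  have T: "clinear2 T" using assms by (simp add: operators_eq_clinear2)
  obtain x where x: "lp_norm p x = 1" "op_norm p T = lp_norm p (T x)"
    and max: "\<And>v. lp_norm p (T v) \<le> lp_norm p (T x) * lp_norm p v"
    by (rule clinear2_attains_op_norm[OF _ T, of p]) (use p in auto)
  show "T = (\<lambda>z. 0)"
  proof (rule ccontr)
    assume nz: "T \<noteq> (\<lambda>z. 0)"
    have Tx: "T x \<noteq> 0"
    proof
      assume "T x = 0"
      then have "lp_norm p (T v) = 0" for v using max[of v] lp_norm_nonneg[of p "T v"] by simp
      then show False using nz by auto
    qed
    define w where "w = T x"
    \<comment> \<open>\<open>u\<close> spans the directions to which \<open>T x\<close> is orthogonal.\<close>
    obtain u :: "complex ^ 2" where u: "u $ 1 = dual_coord p (w $ 2)" "u $ 2 = - dual_coord p (w $ 1)"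
      by (rule vec2_with_coords[of 1 2]) auto
    have "u \<noteq> 0" using Tx u by (auto simp: vec_eq_iff forall_2 w_def)
    have wu: "support_functional p (T x) u = 0" by (simp add: support_functional_def sum_2 u w_def)
    have range: "support_functional p u (T v) = 0" for v
      using not_left_symmetric_of_asymmetric_range[OF p T x Tx wu] sym by blast
    have "\<exists>c. T v = c *s T x" for v
      using support_kernel_line[OF \<open>u \<noteq> 0\<close> Tx range range] by metis
    then have "\<forall>m. \<exists>c. T (axis m 1) = c *s T x" by blast
    then obtain \<gamma> where \<gamma>: "\<And>m. T (axis m 1) = \<gamma> m *s T x" by (auto dest!: choice)
    have rank1: "T v = (\<gamma> k * v $ k + \<gamma> l * v $ l) *s T x" if "k \<noteq> l" for k l v
      using clinear2_coords[OF T that, of v] by (simp add: \<gamma> vec_eq_iff algebra_simps)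
    obtain i where i: "T x $ i \<noteq> 0" using Tx by (auto simp: vec_eq_iff)
    have "x \<noteq> 0" using x by auto
    then obtain k where k: "x $ k \<noteq> 0" by (auto simp: vec_eq_iff)
    define j l where "j = i + 1" and "l = k + 1"
    have ij: "i \<noteq> j" and kl: "k \<noteq> l" by (simp_all add: j_def l_def)
    have no: False if "k \<noteq> l" "x $ k \<noteq> 0" "\<gamma> l \<noteq> 0 \<or> \<gamma> k \<noteq> 0 \<and> T x $ j \<noteq> 0" for k l
      using not_left_symmetric_rank_one[OF p T x ij that(1), of \<gamma>] rank1[OF that(1)] i that(2,3) sym
      by blast
    \<comment> \<open>What is left after excluding each choice of columns is a multiple of a matrix unit.\<close>
    have \<gamma>l: "\<gamma> l = 0" using no[OF kl k] by blast
    have "\<gamma> k \<noteq> 0"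
    proof
      assume "\<gamma> k = 0"
      then have "T x = 0" using rank1[OF kl, of x] \<gamma>l by simp
      then show False using Tx by contradiction
    qed
    then have xl: "x $ l = 0" using no[OF kl[symmetric]] by blast
    have wj: "T x $ j = 0" using no[OF kl k] \<open>\<gamma> k \<noteq> 0\<close> by blast
    have coord: "T v $ m = \<gamma> k * v $ k * T x $ m" for v m
    proof -
      have "T v = (\<gamma> k * v $ k) *s T x" using rank1[OF kl, of v] \<gamma>l by simp
      then show ?thesis by (metis vector_smult_component)
    qed
    have unit: "T v $ i = (\<gamma> k * T x $ i) * v $ k" "T v $ j = 0" for v
      unfolding coord[of v] wj by simp_all
    show False
      using not_left_symmetric_matrix_unit[OF p T x ij kl unit xl] sym i \<open>\<gamma> k \<noteq> 0\<close> by simp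
  qed
qed

end
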